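(* (i) (Quadratic) Fix $n\geq3$ and a real $(n-1)\times(n-1)$ matrix $B$. The map $X_B:W_B\times I_B\times[-1,1]^{n-1}\to\mathbb{R}^{n-1}$, $X_B(w,t;y)=w+(tI+t^2B)y$, where $W_B\subset\mathbb{R}^{n-1}$ is a compact ball and $I_B=[-\tau_B,\tau_B]$ with $\tau_B>0$ small enough that $X_B$ is H\"ormander-type, has a $(\operatorname{rank}B,\ \operatorname{rank}B-\operatorname{rank}B^2)$-lift. (ii) (Polynomial) Fix $n\geq3$, $D\geq1$, compact balls $W,Y\subset\mathbb{R}^{n-1}$, and a compact interval $I\subset\mathbb{R}$. Consider $X_D:W\times I\times Y\to\mathbb{R}^{n-1}$ given by $$X_D(w,t;y)=A_0(w,y)+tA_1(w,y)+\cdots+t^{D-1}A_{D-1}(w,y)+t^DB(y),$$ where the $A_i$ and $B$ are smooth $\mathbb{R}^{n-1}$-valued functions, $\det DB\neq0$ on $Y$, and $X_D$ is H\"ormander-type. Then $X_D$ has a $((D-1)(n-1),0)$-lift. (iii) ($\tan$-example) For $n\geq3$, the map $X_{\tan}:[-0.1,0.1]^{n-1}\times[0.9,1.1]\times[-0.1,0.1]^{n-1}\to\mathbb{R}^{n-1}$, $$X_{\tan}(w,t;y)=\bigl(w'-t^2y',\ \tan^{-1}(w_{n-1}/t)-t\,y_{n-1}\bigr),\quad w=(w',w_{n-1}),\ y=(y',y_{n-1}),\ w',y'\in\mathbb{R}^{n-2},$$ has an $(n,0)$-lift.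
   Context: Let $W,Y\subset\mathbb{R}^{n-1}$ be compact (balls or cubes) and $I\subset\mathbb{R}$ a compact interval. A smooth map $X:W\times I\times Y\to\mathbb{R}^{n-1}$, $(w,t,y)\mapsto X(w,t;y)$, is H\"ormander-type if $\det\nabla_wX\neq0$ and $\det\partial_t[(\nabla_wX)^{-1}\nabla_yX]\neq0$ everywhere on $W\times I\times Y$. Write $\gamma_{y,w}(t)=(X(w,t;y),t)\in\mathbb{R}^n$ for $(y,w)\in Y\times W$, $t\in I$. $(s,\nu)$-lift. For integers $s,\nu\ge0$, and $N=n+s$, $X$ has an $(s,\nu)$-lift if there exist: (a) a compact ball $R\subset\mathbb{R}^s$; (b) an open set $\Omega\subset\mathbb{R}^{N-1}\times\mathbb{R}$ and a smooth submersion $\pi:\Omega\to\mathbb{R}^{n-1}\times\mathbb{R}$ of the form $\pi(z,t)=(\pi_t(z),t)$; (c) smooth maps $a:Y\times W\times R\to\mathbb{R}^{N-1}$ and $\Theta:Y\times R\to\mathbb{R}^{N-1}$ such that for every $(y,w,\rho,t)\in Y\times W\times R\times I$, the point $L_{y,w,\rho}(t):=(a(y,w,\rho)+t\Theta(y,\rho),t)$ lies in $\Omega$ and $\pi(L_{y,w,\rho}(t))=\gamma_{y,w}(t)$, and such that $\operatorname{rank}D\Theta(y,\rho)=N-1-\nu$ on $Y\times R$. (Balls have positive radius; if $s=0$, $R$ is a point.) *)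

theory Defs
  imports "HOL-Analysis.Analysis" "HOL-Library.Poly_Mapping"
begin

text \<open>
  The dimension of the parameter space of a lift depends on a value (such as the rank of a matrix)
  and may be \<open>0\<close>, so it cannot be carried by a type. All the spaces \<open>\<real>\<^sup>m\<close> occurring in a lift are
  therefore realised inside the space of finitely supported real sequences, with its Euclidean
  inner product, as the subspace \<open>euc m\<close> of sequences supported on the first \<open>m\<close> indices.
\<close>

instantiation poly_mapping :: (type, real_vector) real_vector
begin

lift_definition scaleR_poly_mapping :: "real \<Rightarrow> ('a \<Rightarrow>\<^sub>0 'b) \<Rightarrow> ('a \<Rightarrow>\<^sub>0 'b)"
  is "\<lambda>c f k. c *\<^sub>R f k"
  by (rule finite_subset) auto

instance
  by standard (transfer; simp add: fun_eq_iff scaleR_add_right scaleR_add_left)+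

end

lemma lookup_scaleR [simp]: "Poly_Mapping.lookup (c *\<^sub>R x) k = c *\<^sub>R Poly_Mapping.lookup x k"
  by transfer simp

instantiation poly_mapping :: (type, real_inner) real_inner
begin

definition inner_poly_mapping_def:
  "(x :: 'a \<Rightarrow>\<^sub>0 'b) \<bullet> y =
      (\<Sum>k\<in>Poly_Mapping.keys x. Poly_Mapping.lookup x k \<bullet> Poly_Mapping.lookup y k)"

definition norm_poly_mapping_def:
  "norm (x :: 'a \<Rightarrow>\<^sub>0 'b) = sqrt (x \<bullet> x)"

definition sgn_poly_mapping_def:
  "sgn (x :: 'a \<Rightarrow>\<^sub>0 'b) = x /\<^sub>R norm x"

definition dist_poly_mapping_def:
  "dist (x :: 'a \<Rightarrow>\<^sub>0 'b) y = norm (x - y)"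

definition uniformity_poly_mapping_def:
  "(uniformity :: (('a \<Rightarrow>\<^sub>0 'b) \<times> ('a \<Rightarrow>\<^sub>0 'b)) filter) =
      (INF e\<in>{0<..}. principal {(x, y). dist x y < e})"

definition open_poly_mapping_def:
  "open (U :: ('a \<Rightarrow>\<^sub>0 'b) set) \<longleftrightarrow> (\<forall>x\<in>U. eventually (\<lambda>(x', y). x' = x \<longrightarrow> y \<in> U) uniformity)"

lemma inner_poly_mapping_superset:
  assumes "finite K" "Poly_Mapping.keys x \<subseteq> K"
  shows "x \<bullet> y = (\<Sum>k\<in>K. Poly_Mapping.lookup x k \<bullet> Poly_Mapping.lookup y k)"
  unfolding inner_poly_mapping_def
  using assms by (intro sum.mono_neutral_left) (auto simp: in_keys_iff)

instance
proof
  fix x y z :: "'a \<Rightarrow>\<^sub>0 'b" and c :: real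
  let ?K = "Poly_Mapping.keys x \<union> Poly_Mapping.keys y"
  have K: "finite ?K" "Poly_Mapping.keys x \<subseteq> ?K" "Poly_Mapping.keys y \<subseteq> ?K" by auto
  show "x \<bullet> y = y \<bullet> x"
    unfolding inner_poly_mapping_superset[OF K(1,2)] inner_poly_mapping_superset[OF K(1,3)]
    by (simp add: inner_commute)
  have "Poly_Mapping.keys (x + y) \<subseteq> ?K" by (rule keys_add)
  then show "(x + y) \<bullet> z = x \<bullet> z + y \<bullet> z"
    unfolding inner_poly_mapping_superset[OF K(1,2)] inner_poly_mapping_superset[OF K(1,3)]
      inner_poly_mapping_superset[OF K(1) \<open>Poly_Mapping.keys (x + y) \<subseteq> ?K\<close>]
    by (simp add: lookup_add inner_add_left sum.distrib)
  have "Poly_Mapping.keys (c *\<^sub>R x) \<subseteq> Poly_Mapping.keys x" by (auto simp: in_keys_iff)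
  then show "(c *\<^sub>R x) \<bullet> y = c * (x \<bullet> y)"
    by (simp add: inner_poly_mapping_superset[of "Poly_Mapping.keys x"] sum_distrib_left)
  show "0 \<le> x \<bullet> x"
    unfolding inner_poly_mapping_def by (simp add: sum_nonneg)
  show "(x \<bullet> x = 0) = (x = 0)"
    unfolding inner_poly_mapping_def
    by (subst sum_nonneg_eq_0_iff) (auto simp: poly_mapping_eq_iff fun_eq_iff in_keys_iff)
qed (simp_all add: norm_poly_mapping_def sgn_poly_mapping_def dist_poly_mapping_def
      uniformity_poly_mapping_def open_poly_mapping_def)

end

definition euc :: "nat \<Rightarrow> (nat \<Rightarrow>\<^sub>0 real) set"
  where "euc m = {x. Poly_Mapping.keys x \<subseteq> {..<m}}"

lemma norm_euc: "x \<in> euc m \<Longrightarrow> norm x = sqrt (\<Sum>i<m. (Poly_Mapping.lookup x i)\<^sup>2)"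
  by (simp add: norm_poly_mapping_def euc_def inner_poly_mapping_superset[of "{..<m}"]
      power2_eq_square)

lemma euc_0: "euc 0 = {0}"
  by (auto simp: euc_def)

text \<open>
  For open \<open>U\<close>. Iterating the derivatives in all fixed directions \<open>v\<close> avoids the types of higher
  derivatives; on a finite-dimensional space it gives the usual class \<open>C\<^sup>k\<close> for all \<open>k\<close> together.
\<close>

primrec Ck_on :: "nat \<Rightarrow> 'a::real_normed_vector set \<Rightarrow> ('a \<Rightarrow> 'b::real_normed_vector) \<Rightarrow> bool"
  where
    "Ck_on 0 U f \<longleftrightarrow> continuous_on U f"
  | "Ck_on (Suc k) U f \<longleftrightarrow> (\<forall>x\<in>U. f differentiable at x) \<and>
       (\<forall>v. Ck_on k U (\<lambda>x. frechet_derivative f (at x) v))"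

text \<open>
  Smoothness on a set that need not be open (such as a compact ball) means smoothness on an open
  neighbourhood. Functions are total in HOL, so \<open>f\<close> itself is taken to be such an extension, and its
  derivatives at boundary points are ordinary two-sided derivatives (on balls, cubes and intervals
  with interior they do not depend on the extension). If \<open>S \<subseteq> euc m\<close>, or
  if \<open>S\<close> lies in a product with such a factor, the neighbourhood is taken in the ambient space; a
  function that is only given on a neighbourhood in \<open>euc m\<close> extends to one by composition with the
  coordinate projection onto \<open>euc m\<close>, so this is the usual smoothness on \<open>\<real>\<^sup>m\<close>.
\<close>

definition smooth_near :: "'a::real_normed_vector set \<Rightarrow> ('a \<Rightarrow> 'b::real_normed_vector) \<Rightarrow> bool"
  where "smooth_near S f \<longleftrightarrow> (\<exists>U. open U \<and> S \<subseteq> U \<and> (\<forall>k. Ck_on k U f))"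

text \<open>Throughout, \<open>real ^ 'n\<close> plays the role of \<open>\<real>\<^sup>n\<^sup>-\<^sup>1\<close>, that is \<open>CARD('n) = n - 1\<close>.\<close>

definition hormander_type ::
    "(real ^ 'n) set \<Rightarrow> real set \<Rightarrow> (real ^ 'n) set \<Rightarrow>
     (real ^ 'n \<Rightarrow> real \<Rightarrow> real ^ 'n \<Rightarrow> real ^ 'n) \<Rightarrow> bool"
  where "hormander_type W I Y X \<longleftrightarrow>
    smooth_near (W \<times> I \<times> Y) (\<lambda>(w, t, y). X w t y) \<and>
    (\<forall>w\<in>W. \<forall>t\<in>I. \<forall>y\<in>Y.
       det (jacobian (\<lambda>w. X w t y) (at w)) \<noteq> 0 \<and>
       det (vector_derivative
              (\<lambda>t. matrix_inv (jacobian (\<lambda>w. X w t y) (at w)) ** jacobian (\<lambda>y. X w t y) (at y))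
              (at t)) \<noteq> 0)"

text \<open>
  Here \<open>N - 1 = CARD('n) + s\<close>. The derivatives of \<open>\<pi>\<close> and \<open>\<Theta>\<close> are restricted to the tangent spaces
  \<open>\<real>\<^sup>N\<^sup>-\<^sup>1 \<times> \<real>\<close> and \<open>\<real>\<^sup>n\<^sup>-\<^sup>1 \<times> \<real>\<^sup>s\<close> of their domains. The rank condition \<open>rank D\<Theta> = N - 1 - \<nu>\<close> is written
  additively, so that it fails, rather than being truncated, for \<open>\<nu> > N - 1\<close>.
\<close>

definition has_lift ::
    "(real ^ 'n) set \<Rightarrow> real set \<Rightarrow> (real ^ 'n) set \<Rightarrow>
     (real ^ 'n \<Rightarrow> real \<Rightarrow> real ^ 'n \<Rightarrow> real ^ 'n) \<Rightarrow> nat \<Rightarrow> nat \<Rightarrow> bool"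
  where "has_lift W I Y X s \<nu> \<longleftrightarrow>
    (\<exists>c r R \<Omega>.
     \<exists>\<pi> :: (nat \<Rightarrow>\<^sub>0 real) \<times> real \<Rightarrow> (real ^ 'n) \<times> real.
     \<exists>a :: (real ^ 'n) \<times> (real ^ 'n) \<times> (nat \<Rightarrow>\<^sub>0 real) \<Rightarrow> (nat \<Rightarrow>\<^sub>0 real).
     \<exists>\<Theta> :: (real ^ 'n) \<times> (nat \<Rightarrow>\<^sub>0 real) \<Rightarrow> (nat \<Rightarrow>\<^sub>0 real).
       c \<in> euc s \<and> r > 0 \<and> R = cball c r \<inter> euc s \<and>
       openin (top_of_set (euc (CARD('n) + s) \<times> UNIV)) \<Omega> \<and>
       smooth_near \<Omega> \<pi> \<and>
       (\<forall>p\<in>\<Omega>. frechet_derivative \<pi> (at p) ` (euc (CARD('n) + s) \<times> UNIV) = UNIV) \<and>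
       (\<forall>z t. (z, t) \<in> \<Omega> \<longrightarrow> snd (\<pi> (z, t)) = t) \<and>
       smooth_near (Y \<times> W \<times> R) a \<and> a ` (Y \<times> W \<times> R) \<subseteq> euc (CARD('n) + s) \<and>
       smooth_near (Y \<times> R) \<Theta> \<and> \<Theta> ` (Y \<times> R) \<subseteq> euc (CARD('n) + s) \<and>
       (\<forall>y\<in>Y. \<forall>w\<in>W. \<forall>\<rho>\<in>R. \<forall>t\<in>I.
          (a (y, w, \<rho>) + t *\<^sub>R \<Theta> (y, \<rho>), t) \<in> \<Omega> \<and>
          \<pi> (a (y, w, \<rho>) + t *\<^sub>R \<Theta> (y, \<rho>), t) = (X w t y, t)) \<and>
       (\<forall>y\<in>Y. \<forall>\<rho>\<in>R.
          dim (frechet_derivative \<Theta> (at (y, \<rho>)) ` (UNIV \<times> euc s)) + \<nu> = CARD('n) + s))"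

definition X_quad :: "real ^ 'n ^ 'n \<Rightarrow> real ^ 'n \<Rightarrow> real \<Rightarrow> real ^ 'n \<Rightarrow> real ^ 'n"
  where "X_quad B w t y = w + (t *\<^sub>R mat 1 + t\<^sup>2 *\<^sub>R B) *v y"

definition X_poly ::
    "nat \<Rightarrow> (nat \<Rightarrow> real ^ 'n \<Rightarrow> real ^ 'n \<Rightarrow> real ^ 'n) \<Rightarrow> (real ^ 'n \<Rightarrow> real ^ 'n) \<Rightarrow>
     real ^ 'n \<Rightarrow> real \<Rightarrow> real ^ 'n \<Rightarrow> real ^ 'n"
  where "X_poly D A B w t y = (\<Sum>i<D. t ^ i *\<^sub>R A i w y) + t ^ D *\<^sub>R B y"

text \<open>
  An index type carries no order, so the coordinate that is called last is an argument \<open>l\<close>.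
\<close>

definition X_tan :: "'n \<Rightarrow> real ^ 'n \<Rightarrow> real \<Rightarrow> real ^ 'n \<Rightarrow> real ^ 'n"
  where "X_tan l w t y =
    (\<chi> i. if i = l then arctan (w $ l / t) - t * y $ l else w $ i - t\<^sup>2 * y $ i)"

definition cube :: "real \<Rightarrow> (real ^ 'n) set"
  where "cube r = cbox (\<chi> i. - r) (\<chi> i. r)"

end

(*
  Each lift is z = (x, u) with x in R^(n-1), and the projection is pi_t(x, u) = x + G(u, t), which is
  a submersion whatever G is. In each case the auxiliary parameter rho shifts slopes in one block of
  coordinates against offsets in another, without changing the projected curve.

  Quadratic: G = t u with u in range B, so u = rho + t B y and x = w + t (y - rho). The image of
  (y, rho) |-> (y - rho, B y) on R^(n-1) x range B consists of the points (x, B x + z) with z in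
  range B^2, so the slope map has rank n - 1 + rank B^2.

  Polynomial: G = t x_1 + ... + t^(D-1) x_(D-1) with all blocks x_k in R^(n-1). The first D - 1 slopes
  are the free parameters rho_k, the last one is B y, and the offsets A_k - rho_(k-1) compensate.

  Tangent: the coordinates other than the last are treated as in the quadratic case. For the last one,
  arctan (w / t) is the argument of the complex number t + i w. Multiplying by u + i v adds
  arctan (v / u), so arctan (w / t) - t y = x + arctan (q / p) on the line given by
  p + i q = (u + i v) (t + i w) and x = - arctan (v / u) - t y, whose slope is (u, v, - y).
*)

theory Submission imports Defs
begin

subsection \<open>Smooth maps\<close>

lemma Ck_on_SucD:
  assumes "Ck_on (Suc k) U f" "x \<in> U"
  shows "(f has_derivative frechet_derivative f (at x)) (at x)"
  using assms by (simp add: frechet_derivative_works)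

text \<open>Because \<open>U\<close> is open, agreement on \<open>U\<close> is agreement near each
  point, so the derivatives agree as well.\<close>

lemma Ck_on_cong:
  assumes "open U" "Ck_on k U f" "\<And>x. x \<in> U \<Longrightarrow> f x = g x"
  shows "Ck_on k U g"
  using assms(2,3)
proof (induction k arbitrary: f g)
  case 0
  then show ?case by (simp cong: continuous_on_cong)
next
  case (Suc k)
  have g: "(g has_derivative frechet_derivative f (at x)) (at x)" if "x \<in> U" for x
    using has_derivative_transform_within_open[OF Ck_on_SucD[OF Suc.prems(1) that] assms(1) that]
      Suc.prems(2) by blast
  then have eq: "frechet_derivative f (at x) = frechet_derivative g (at x)" if "x \<in> U" for x
    using that frechet_derivative_at by blast
  have "Ck_on k U (\<lambda>x. frechet_derivative g (at x) v)" for v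
    using Suc.IH[of "\<lambda>x. frechet_derivative f (at x) v"] Suc.prems(1) eq by simp
  with g show ?case by (auto simp: differentiable_def)
qed

text \<open>Replaces the derivative chosen by \<open>frechet_derivative\<close> with an explicit
  formula \<open>f'\<close>; this is the form in which most closure rules below do their induction
  step.\<close>

lemma Ck_on_SucI:
  assumes "open U" "\<And>x. x \<in> U \<Longrightarrow> (f has_derivative f' x) (at x)"
    and "\<And>v. Ck_on k U (\<lambda>x. f' x v)"
  shows "Ck_on (Suc k) U f"
proof -
  have eq: "f' x = frechet_derivative f (at x)" if "x \<in> U" for x
    using assms(2)[OF that] frechet_derivative_at by blast
  have "Ck_on k U (\<lambda>x. frechet_derivative f (at x) v)" for v
    by (rule Ck_on_cong[OF assms(1) assms(3)[of v]]) (simp add: eq)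
  then show ?thesis using assms(2) by (auto simp: differentiable_def)
qed

lemma Ck_on_Suc_imp: "Ck_on (Suc k) U f \<Longrightarrow> Ck_on k U f"
proof (induction k arbitrary: f)
  case 0
  then show ?case
    by (auto intro!: continuous_at_imp_continuous_on differentiable_imp_continuous_within)
qed auto

lemma Ck_on_const: "open U \<Longrightarrow> Ck_on k U (\<lambda>x. c)"
proof (induction k arbitrary: c)
  case (Suc k)
  show ?case by (rule Ck_on_SucI[where f' = "\<lambda>x v. 0"]) (use Suc in auto)
qed simp

lemma Ck_on_linear:
  assumes "open U" "bounded_linear f"
  shows "Ck_on k U f"
proof (cases k)
  case 0
  then show ?thesis using assms by (simp add: linear_continuous_on)
next
  case (Suc m)
  show ?thesis unfolding Suc
    by (rule Ck_on_SucI[where f' = "\<lambda>x. f"])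
      (use assms in \<open>auto intro: bounded_linear_imp_has_derivative Ck_on_const\<close>)
qed

lemma Ck_on_linear_comp:
  assumes "open U" "bounded_linear L" "Ck_on k U f"
  shows "Ck_on k U (\<lambda>x. L (f x))"
  using assms(3)
proof (induction k arbitrary: f)
  case 0
  then show ?case using assms(2) by (simp add: bounded_linear.continuous_on)
next
  case (Suc k)
  show ?case
    by (rule Ck_on_SucI[where f' = "\<lambda>x v. L (frechet_derivative f (at x) v)"])
      (use Suc assms in \<open>auto intro!: bounded_linear.has_derivative[OF assms(2)] Ck_on_SucD\<close>)
qed

text \<open>The derivative of the composite at \<open>x\<close> in direction \<open>v\<close> is
  that of \<open>f\<close> at \<open>L x\<close> in the fixed direction \<open>L v\<close>, so the
  induction stays within directional derivatives. A nonlinear inner map would make the direction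
  depend on the point.\<close>

lemma Ck_on_comp_linear:
  assumes "open V" "bounded_linear L" "Ck_on k U f" "L ` V \<subseteq> U"
  shows "Ck_on k V (\<lambda>x. f (L x))"
  using assms(3)
proof (induction k arbitrary: f)
  case 0
  then show ?case
    using assms(2,4) by (auto intro: continuous_on_compose2 linear_continuous_on)
next
  case (Suc k)
  show ?case
  proof (rule Ck_on_SucI[where f' = "\<lambda>x v. frechet_derivative f (at (L x)) (L v)"])
    fix x assume "x \<in> V"
    then have "(f has_derivative frechet_derivative f (at (L x))) (at (L x))"
      using assms(4) Suc.prems by (intro Ck_on_SucD) auto
    then show "((\<lambda>x. f (L x)) has_derivative (\<lambda>v. frechet_derivative f (at (L x)) (L v))) (at x)"
      by (rule has_derivative_compose[OF bounded_linear_imp_has_derivative[OF assms(2)]])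
  next
    show "Ck_on k V (\<lambda>x. frechet_derivative f (at (L x)) (L v))" for v
      using Suc.IH[of "\<lambda>z. frechet_derivative f (at z) (L v)"] Suc.prems by simp
  qed (rule assms(1))
qed

section \<open>Sums, products, reciprocals and arctangents of smooth maps\<close>

lemma Ck_on_add:
  assumes "open U" "Ck_on k U f" "Ck_on k U g"
  shows "Ck_on k U (\<lambda>x. f x + g x)"
  using assms(2,3)
proof (induction k arbitrary: f g)
  case 0
  then show ?case by (auto intro: continuous_on_add)
next
  case (Suc k)
  show ?case
    by (rule Ck_on_SucI[where
          f' = "\<lambda>x v. frechet_derivative f (at x) v + frechet_derivative g (at x) v"])
      (use Suc assms(1) in \<open>auto intro!: has_derivative_add Ck_on_SucD\<close>)
qed

lemma Ck_on_sum:
  assumes "open U" "\<And>i. i \<in> S \<Longrightarrow> Ck_on k U (f i)"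
  shows "Ck_on k U (\<lambda>x. \<Sum>i\<in>S. f i x)"
  using assms(2)
  by (induction S rule: infinite_finite_induct) (auto intro: Ck_on_const Ck_on_add assms(1))

text \<open>By the Leibniz rule each directional derivative is a sum of products with one
  undifferentiated factor, which is why \<open>Ck_on_Suc_imp\<close> enters.\<close>

lemma Ck_on_bilinear:
  assumes "open U" "bounded_bilinear P" "Ck_on k U f" "Ck_on k U g"
  shows "Ck_on k U (\<lambda>x. P (f x) (g x))"
  using assms(3,4)
proof (induction k arbitrary: f g)
  case 0
  then show ?case by (auto intro: bounded_bilinear.continuous_on[OF assms(2)])
next
  case (Suc k)
  show ?case
    by (rule Ck_on_SucI[where f' = "\<lambda>x v. P (f x) (frechet_derivative g (at x) v)
          + P (frechet_derivative f (at x) v) (g x)"])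
      (use Suc Suc.prems[THEN Ck_on_Suc_imp] assms(1) in
        \<open>auto intro!: bounded_bilinear.FDERIV[OF assms(2)] Ck_on_SucD Ck_on_add\<close>)
qed

lemmas Ck_on_scaleR = Ck_on_bilinear[OF _ bounded_bilinear_scaleR]
lemmas Ck_on_mult = Ck_on_bilinear[OF _ bounded_bilinear_mult]

lemma Ck_on_uminus: "open U \<Longrightarrow> Ck_on k U f \<Longrightarrow> Ck_on k U (\<lambda>x. - f x)"
  by (rule Ck_on_linear_comp[OF _ bounded_linear_minus[OF bounded_linear_ident]])

lemma Ck_on_diff:
  "open U \<Longrightarrow> Ck_on k U f \<Longrightarrow> Ck_on k U g \<Longrightarrow> Ck_on k U (\<lambda>x. f x - g x)"
  using Ck_on_add[of U k f "\<lambda>x. - g x"] by (simp add: Ck_on_uminus)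

lemma Ck_on_power:
  fixes f :: "'a::real_normed_vector \<Rightarrow> real"
  assumes "open U" "Ck_on k U f"
  shows "Ck_on k U (\<lambda>x. f x ^ m)"
  by (induction m) (auto intro!: Ck_on_const Ck_on_mult assms)

text \<open>The derivative contains the reciprocal itself, but only at order \<open>k\<close>, where
  the induction hypothesis supplies it.\<close>

lemma Ck_on_inverse:
  fixes f :: "'a::real_normed_vector \<Rightarrow> real"
  assumes "open U" "\<And>x. x \<in> U \<Longrightarrow> f x \<noteq> 0"
  shows "Ck_on k U f \<Longrightarrow> Ck_on k U (\<lambda>x. inverse (f x))"
proof (induction k)
  case 0
  then show ?case using assms(2) by (auto intro: continuous_on_inverse)
next
  case (Suc k)
  have inv: "Ck_on k U (\<lambda>x. inverse (f x))"
    by (rule Suc.IH[OF Ck_on_Suc_imp[OF Suc.prems]])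
  show ?case
    by (rule Ck_on_SucI[where
          f' = "\<lambda>x v. - (inverse (f x) * frechet_derivative f (at x) v * inverse (f x))"])
      (use Suc.prems inv assms in
        \<open>auto intro!: Deriv.has_derivative_inverse Ck_on_SucD Ck_on_uminus Ck_on_mult\<close>)
qed

text \<open>Differentiation removes the arctangent and leaves a quotient with denominator 1 + f^2,
  so a case split replaces induction.\<close>

lemma Ck_on_arctan:
  fixes f :: "'a::real_normed_vector \<Rightarrow> real"
  assumes "open U" "Ck_on k U f"
  shows "Ck_on k U (\<lambda>x. arctan (f x))"
proof (cases k)
  case 0
  then show ?thesis using assms by (auto intro: continuous_on_arctan)
next
  case (Suc m)
  have f: "Ck_on (Suc m) U f" using assms(2) Suc by simp
  have ne: "1 + f x ^ 2 \<noteq> 0" for x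
    by (metis add_pos_nonneg less_irrefl zero_le_power2 zero_less_one)
  have "Ck_on m U (\<lambda>x. inverse (1 + (f x)\<^sup>2))"
    using Ck_on_Suc_imp[OF f] assms(1) ne
    by (intro Ck_on_inverse Ck_on_add Ck_on_power Ck_on_const) auto
  moreover have "((\<lambda>x. arctan (f x)) has_derivative
      (\<lambda>v. frechet_derivative f (at x) v * inverse (1 + (f x)\<^sup>2))) (at x)" if "x \<in> U" for x
    using has_derivative_arctan[OF Ck_on_SucD[OF f that]] by (simp add: mult.commute)
  ultimately show ?thesis
    unfolding Suc using f assms(1)
    by (intro Ck_on_SucI[where
          f' = "\<lambda>x v. frechet_derivative f (at x) v * inverse (1 + (f x)\<^sup>2)"] Ck_on_mult) auto
qed

lemma Ck_on_Pair:
  assumes "open U" "Ck_on k U f" "Ck_on k U g"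
  shows "Ck_on k U (\<lambda>x. (f x, g x))"
proof -
  have "Ck_on k U (\<lambda>x. (f x, 0) + (0, g x))"
    by (intro Ck_on_add assms
        Ck_on_linear_comp[OF _ bounded_linear_Pair[OF bounded_linear_ident bounded_linear_zero]]
        Ck_on_linear_comp[OF _ bounded_linear_Pair[OF bounded_linear_zero bounded_linear_ident]])
  then show ?thesis by simp
qed

lemma Ck_on_vec_lambda:
  fixes f :: "'n::finite \<Rightarrow> 'a::real_normed_vector \<Rightarrow> real"
  assumes "open U" "\<And>i. Ck_on k U (f i)"
  shows "Ck_on k U (\<lambda>x. \<chi> i. f i x)"
proof -
  have "Ck_on k U (\<lambda>x. \<Sum>i\<in>UNIV. f i x *\<^sub>R (axis i 1 :: real ^ 'n))"
    using assms by (intro Ck_on_sum Ck_on_scaleR Ck_on_const) auto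
  then show ?thesis
    by (rule Ck_on_cong[OF assms(1)]) (simp add: vec_eq_iff axis_def if_distrib cong: if_cong)
qed

text \<open>The condition is independent of the point; this handles coordinates given by cases on
  the index.\<close>

lemma Ck_on_if:
  assumes "P \<Longrightarrow> Ck_on k U f" "\<not> P \<Longrightarrow> Ck_on k U g"
  shows "Ck_on k U (\<lambda>x. if P then f x else g x)"
  using assms by (cases P) auto

lemma Ck_on_id: "open U \<Longrightarrow> Ck_on k U (\<lambda>x. x)"
  by (rule Ck_on_linear) (auto intro: bounded_linear_ident)

lemma Ck_on_fst: "open U \<Longrightarrow> Ck_on k U f \<Longrightarrow> Ck_on k U (\<lambda>x. fst (f x))"
  by (rule Ck_on_linear_comp[OF _ bounded_linear_fst])

lemma Ck_on_snd: "open U \<Longrightarrow> Ck_on k U f \<Longrightarrow> Ck_on k U (\<lambda>x. snd (f x))"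
  by (rule Ck_on_linear_comp[OF _ bounded_linear_snd])

lemma Ck_on_vec_nth: "open U \<Longrightarrow> Ck_on k U f \<Longrightarrow> Ck_on k U (\<lambda>x. f x $ i)"
  by (rule Ck_on_linear_comp[OF _ bounded_linear_vec_nth])

lemma smooth_nearI: "open U \<Longrightarrow> S \<subseteq> U \<Longrightarrow> (\<And>k. Ck_on k U f) \<Longrightarrow> smooth_near S f"
  unfolding smooth_near_def by blast

subsection \<open>Coordinates\<close>

lemma lookup_sum: "Poly_Mapping.lookup (\<Sum>i\<in>S. f i) k = (\<Sum>i\<in>S. Poly_Mapping.lookup (f i) k)"
  by (induction S rule: infinite_finite_induct) (auto simp: lookup_add)

lemma abs_lookup_le_norm:
  fixes x :: "'a \<Rightarrow>\<^sub>0 real"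
  shows "\<bar>Poly_Mapping.lookup x k\<bar> \<le> norm x"
proof -
  \<comment> \<open>Adjoining \<open>k\<close> covers a coordinate outside the support.\<close>
  let ?K = "insert k (Poly_Mapping.keys x)"
  have "(Poly_Mapping.lookup x k)\<^sup>2 \<le> (\<Sum>j\<in>?K. (Poly_Mapping.lookup x j)\<^sup>2)"
    by (rule member_le_sum) auto
  also have "\<dots> = (norm x)\<^sup>2"
    by (simp only: power2_norm_eq_inner)
      (subst inner_poly_mapping_superset[of ?K]; force simp: power2_eq_square)
  finally show ?thesis by (simp add: power2_le_iff_abs_le)
qed

lemma bounded_linear_lookup: "bounded_linear (\<lambda>x :: 'a \<Rightarrow>\<^sub>0 real. Poly_Mapping.lookup x k)"
  by (rule bounded_linear_intro[where K = 1]) (simp_all add: lookup_add abs_lookup_le_norm)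

lemma Ck_on_lookup:
  fixes f :: "'a::real_normed_vector \<Rightarrow> 'b \<Rightarrow>\<^sub>0 real"
  shows "open U \<Longrightarrow> Ck_on k U f \<Longrightarrow> Ck_on k U (\<lambda>x. Poly_Mapping.lookup (f x) i)"
  by (rule Ck_on_linear_comp[OF _ bounded_linear_lookup])

lemmas Ck_on_intros = Ck_on_const Ck_on_id Ck_on_fst Ck_on_snd Ck_on_vec_nth Ck_on_lookup
  Ck_on_uminus Ck_on_add Ck_on_diff Ck_on_mult Ck_on_scaleR Ck_on_sum Ck_on_power Ck_on_if

text \<open>A finite combination of unit sequences, so that smoothness and linearity of a
  sequence-valued map reduce to its coordinates.\<close>

definition vec_euc :: "nat \<Rightarrow> (nat \<Rightarrow> real) \<Rightarrow> nat \<Rightarrow>\<^sub>0 real"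
  where "vec_euc m f = (\<Sum>i<m. f i *\<^sub>R Poly_Mapping.single i 1)"

lemma lookup_vec_euc: "Poly_Mapping.lookup (vec_euc m f) k = (if k < m then f k else 0)"
  by (simp add: vec_euc_def lookup_sum lookup_single when_def if_distrib cong: if_cong)

lemma euc_iff: "x \<in> euc m \<longleftrightarrow> (\<forall>k\<ge>m. Poly_Mapping.lookup x k = 0)"
  by (force simp: euc_def in_keys_iff not_le subset_iff)

lemma vec_euc_in_euc [simp]: "vec_euc m f \<in> euc m"
  by (simp add: euc_iff lookup_vec_euc)

lemma vec_euc_lookup: "x \<in> euc m \<Longrightarrow> vec_euc m (Poly_Mapping.lookup x) = x"
  by (auto intro!: poly_mapping_eqI simp: lookup_vec_euc euc_iff not_less)

lemma Ck_on_vec_euc: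
  assumes "open U" "\<And>i. i < m \<Longrightarrow> Ck_on k U (\<lambda>x. f x i)"
  shows "Ck_on k U (\<lambda>x. vec_euc m (f x))"
  unfolding vec_euc_def using assms by (intro Ck_on_sum Ck_on_scaleR Ck_on_const) auto

lemma bounded_linear_vec_euc:
  assumes "\<And>i. i < m \<Longrightarrow> bounded_linear (\<lambda>x. f x i)"
  shows "bounded_linear (\<lambda>x. vec_euc m (f x))"
  unfolding vec_euc_def using assms
  by (intro bounded_linear_sum bounded_linear_compose[OF bounded_linear_scaleR_left]) auto

lemma bounded_linear_if:
  assumes "P \<Longrightarrow> bounded_linear f" "\<not> P \<Longrightarrow> bounded_linear g"
  shows "bounded_linear (\<lambda>x. if P then f x else g x)"
  using assms by (cases P) auto

section \<open>Dimensions of subspaces of finitely supported sequences\<close>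

text \<open>An injective linear map carries a basis of \<open>S\<close> to a basis of the image.
  Arbitrary vector spaces are allowed because the finitely supported sequences are
  infinite-dimensional.\<close>

lemma dim_injective_image:
  fixes f :: "'a::real_vector \<Rightarrow> 'b::real_vector"
  assumes "linear f" "subspace S" "inj_on f S"
  shows "dim (f ` S) = dim S"
proof -
  obtain C where C: "C \<subseteq> S" "independent C" "S \<subseteq> span C" "card C = dim S"
    by (rule basis_exists)
  have sp: "span C = S" using C(1,3) assms(2) by (simp add: span_minimal subset_antisym)
  then have "independent (f ` C)"
    using assms(3) C(2) by (simp add: linear_independent_injective_image[OF assms(1)])
  moreover have "f ` S = span (f ` C)" using sp linear_span_image[OF assms(1)] by metis
  ultimately have "dim (f ` S) = card (f ` C)" by (metis real_vector.dim_span_eq_card_independent)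
  also have "\<dots> = card C" using assms(3) C(1) by (intro card_image) (blast intro: inj_on_subset)
  finally show ?thesis using C(4) by simp
qed

text \<open>The first \<open>m\<close> unit sequences are a basis; their independence is read off
  coordinate by coordinate.\<close>

lemma dim_euc: "dim (euc m) = m"
proof -
  let ?B = "(\<lambda>i. Poly_Mapping.single i (1::real)) ` {..<m}"
  have inj: "inj_on (\<lambda>i. Poly_Mapping.single i (1::real)) A" for A :: "nat set"
    by (intro inj_onI) (metis lookup_single_eq lookup_single_not_eq zero_neq_one)
  have "independent ?B"
  proof (rule real_vector.independent_if_scalars_zero)
    fix f x assume *: "(\<Sum>x\<in>?B. f x *\<^sub>R x) = 0" and "x \<in> ?B"
    then obtain i where i: "i < m" "x = Poly_Mapping.single i 1" by auto
    have "vec_euc m (\<lambda>i. f (Poly_Mapping.single i 1)) = 0"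
      using * by (simp add: sum.reindex[OF inj] vec_euc_def)
    from arg_cong[OF this, of "\<lambda>x. Poly_Mapping.lookup x i"] i
    show "f x = 0" by (simp add: lookup_vec_euc)
  qed simp
  moreover have "span ?B = euc m"
  proof
    have "subspace (euc m)" by (auto simp: subspace_def euc_iff lookup_add)
    then show "span ?B \<subseteq> euc m"
      by (rule span_minimal[rotated]) (auto simp: euc_iff lookup_single when_def)
    show "euc m \<subseteq> span ?B"
    proof
      fix x assume "x \<in> euc m"
      then have "x = (\<Sum>i<m. Poly_Mapping.lookup x i *\<^sub>R Poly_Mapping.single i 1)"
        using vec_euc_lookup unfolding vec_euc_def by metis
      also have "\<dots> \<in> span ?B" by (intro span_sum span_scale span_base) auto
      finally show "x \<in> span ?B" .
    qed
  qed
  ultimately have "dim (euc m) = card ?B"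
    by (metis real_vector.dim_span_eq_card_independent)
  then show ?thesis using card_image[OF inj] by simp
qed

section \<open>Vectors as initial blocks of sequences\<close>

text \<open>An arbitrary numbering of the index type, which carries no order of its own; it assigns
  positions in a sequence to the coordinates of a vector.\<close>

definition ix :: "'n::finite \<Rightarrow> nat"
  where "ix = (SOME f. bij_betw f UNIV {..<CARD('n)})"

lemma bij_betw_ix: "bij_betw (ix :: 'n::finite \<Rightarrow> nat) UNIV {..<CARD('n)}"
  unfolding ix_def atLeast0LessThan[symmetric] by (rule someI_ex[OF ex_bij_betw_finite_nat[OF finite]])

lemma ix_less [simp]: "ix (i :: 'n::finite) < CARD('n)"
  using bij_betw_ix by (auto simp: bij_betw_def)

lemma inj_ix: "inj ix"
  using bij_betw_ix by (auto simp: bij_betw_def)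

lemma inv_ix_ix [simp]: "inv ix (ix i) = i"
  using inj_ix by (rule inv_f_f)

lemma ix_eq_iff [simp]: "ix i = ix j \<longleftrightarrow> i = j"
  using inj_ix by (auto dest: injD)

lemma ix_inv_ix [simp]: "k < CARD('n) \<Longrightarrow> ix (inv ix k :: 'n::finite) = k"
  using bij_betw_ix by (metis bij_betw_def f_inv_into_f lessThan_iff)

definition emb :: "real ^ 'n \<Rightarrow> (nat \<Rightarrow>\<^sub>0 real)"
  where "emb x = vec_euc CARD('n) (\<lambda>k. x $ inv ix k)"

lemma lookup_emb:
  "Poly_Mapping.lookup (emb (x :: real ^ 'n)) k = (if k < CARD('n) then x $ inv ix k else 0)"
  by (simp add: emb_def lookup_vec_euc)

subsection \<open>Lifts\<close>

lemma has_derivative_line: "((\<lambda>h :: real. p + h *\<^sub>R q) has_derivative (\<lambda>h. h *\<^sub>R q)) (at x)"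
  by (auto intro!: derivative_eq_intros)

text \<open>
  The hypothesis \<open>shift\<close> says that \<open>F\<close> is the identity in the first block of coordinates up to a term
  that does not depend on them, which makes \<open>(z, t) \<mapsto> (F (z, t), t)\<close> a submersion.
\<close>

lemma has_liftI:
  fixes F :: "(nat \<Rightarrow>\<^sub>0 real) \<times> real \<Rightarrow> real ^ 'n" and \<beta> :: "real ^ 'n \<Rightarrow> real ^ 'n"
    and \<Phi> :: "(real ^ 'n) \<times> (nat \<Rightarrow>\<^sub>0 real) \<Rightarrow> (nat \<Rightarrow>\<^sub>0 real)"
  assumes c: "c \<in> euc s" "0 < r" and U: "open U" "\<And>k. Ck_on k U F"
    and shift: "\<And>z x t. F (z + emb x, t) = F (z, t) + x"
    and a: "smooth_near (Y \<times> W \<times> (cball c r \<inter> euc s)) a" "range a \<subseteq> euc (CARD('n) + s)"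
    and \<Phi>: "bounded_linear \<Phi>" "range \<Phi> \<subseteq> euc (CARD('n) + s)"
    and \<beta>: "smooth_near Y \<beta>" "\<And>y. y \<in> Y \<Longrightarrow> surj (frechet_derivative \<beta> (at y))"
    and dim: "dim (\<Phi> ` (UNIV \<times> euc s)) + \<nu> = CARD('n) + s"
    and line: "\<And>y w \<rho> t. y \<in> Y \<Longrightarrow> w \<in> W \<Longrightarrow> \<rho> \<in> cball c r \<inter> euc s \<Longrightarrow> t \<in> I \<Longrightarrow>
      (a (y, w, \<rho>) + t *\<^sub>R \<Phi> (\<beta> y, \<rho>), t) \<in> U \<and>
      F (a (y, w, \<rho>) + t *\<^sub>R \<Phi> (\<beta> y, \<rho>), t) = X w t y"
  shows "has_lift W I Y X s \<nu>"
proof -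
  define \<pi> where "\<pi> = (\<lambda>p. (F p, snd p))"
  define \<Theta> where "\<Theta> = (\<lambda>p. \<Phi> (\<beta> (fst p), snd p))"
  let ?E = "euc (CARD('n) + s)"
  have \<pi>_smooth: "Ck_on k U \<pi>" for k
    unfolding \<pi>_def using U by (intro Ck_on_Pair Ck_on_linear[OF _ bounded_linear_snd])
  have submersion: "frechet_derivative \<pi> (at p) ` (?E \<times> UNIV) = UNIV" if "p \<in> U" for p
  proof -
    obtain z0 t0 where p: "p = (z0, t0)" by fastforce
    let ?D = "frechet_derivative \<pi> (at p)"
    have D: "(\<pi> has_derivative ?D) (at p)"
      using \<pi>_smooth[of "Suc 0"] that by (intro Ck_on_SucD)
    then have lin: "linear ?D" by (rule has_derivative_linear)
    \<comment> \<open>By \<open>shift\<close>, \<open>\<pi>\<close> is affine along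
      \<open>(emb x, 0)\<close>, which determines its derivative in that direction.\<close>
    have Dx: "?D (emb x, 0) = (x, 0)" for x
    proof -
      let ?q = "(emb x, 0) :: (nat \<Rightarrow>\<^sub>0 real) \<times> real"
      have "((\<lambda>h :: real. p + h *\<^sub>R ?q) has_derivative (\<lambda>h. h *\<^sub>R ?q)) (at 0)" by (rule has_derivative_line)
      then have "((\<lambda>h :: real. \<pi> (p + h *\<^sub>R ?q)) has_derivative (\<lambda>h. ?D (h *\<^sub>R ?q))) (at 0)"
        by (rule has_derivative_compose) (simp only: scaleR_zero_left add_0_right D)
      moreover have "(\<lambda>h :: real. \<pi> (p + h *\<^sub>R (emb x, 0))) = (\<lambda>h. \<pi> p + h *\<^sub>R (x, 0))"
      proof
        fix h :: real
        have "h *\<^sub>R emb x = emb (h *\<^sub>R x)"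
          by (rule poly_mapping_eqI) (simp add: lookup_emb)
        then show "\<pi> (p + h *\<^sub>R (emb x, 0)) = \<pi> p + h *\<^sub>R (x, 0)"
          by (simp add: \<pi>_def p shift)
      qed
      moreover have "((\<lambda>h :: real. \<pi> p + h *\<^sub>R (x, 0)) has_derivative (\<lambda>h. h *\<^sub>R (x, 0))) (at 0)" by (rule has_derivative_line)
      ultimately have "(\<lambda>h :: real. ?D (h *\<^sub>R (emb x, 0))) = (\<lambda>h. h *\<^sub>R (x, 0))"
        using has_derivative_unique by metis
      from fun_cong[OF this, of 1] show ?thesis by simp
    qed
    have snd: "snd (?D q) = snd q" for q
    proof -
      have "((\<lambda>p. snd (\<pi> p)) has_derivative snd) (at p)"
        by (simp add: \<pi>_def bounded_linear_imp_has_derivative[OF bounded_linear_snd])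
      from has_derivative_unique[OF has_derivative_snd[OF D] this] show ?thesis by (rule fun_cong)
    qed
    \<comment> \<open>The direction \<open>(0, snd v)\<close> gives the right time component with
      spatial part \<open>g\<close>; adding \<open>emb (fst v - g)\<close> corrects the spatial
      part.\<close>
    have "v \<in> ?D ` (?E \<times> UNIV)" for v
    proof -
      obtain g where g: "?D (0, snd v) = (g, snd v)"
        using snd[of "(0, snd v)"] by (metis prod.collapse snd_conv)
      have "?D (emb (fst v - g), snd v) = ?D (emb (fst v - g), 0) + ?D (0, snd v)"
        using linear_add[OF lin, of "(emb (fst v - g), 0)" "(0, snd v)"] by simp
      also have "\<dots> = v" by (simp add: Dx g)
      finally have "v = ?D (emb (fst v - g), snd v)" by simp
      moreover have "emb (fst v - g) \<in> ?E" by (simp add: euc_iff lookup_emb)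
      ultimately show ?thesis by blast
    qed
    then show ?thesis by blast
  qed
  obtain V where V: "open V" "Y \<subseteq> V" "\<And>k. Ck_on k V \<beta>"
    using \<beta>(1) by (auto simp: smooth_near_def)
  have \<Theta>_smooth: "smooth_near (Y \<times> (cball c r \<inter> euc s)) \<Theta>"
  proof (rule smooth_nearI[where U = "V \<times> UNIV"])
    fix k
    have o: "open (V \<times> UNIV :: ((real ^ 'n) \<times> (nat \<Rightarrow>\<^sub>0 real)) set)"
      using V(1) by (simp add: open_Times)
    then have "Ck_on k (V \<times> UNIV) (\<lambda>p. (\<beta> (fst p), snd p) :: (real ^ 'n) \<times> (nat \<Rightarrow>\<^sub>0 real))"
      by (intro Ck_on_Pair Ck_on_comp_linear[OF _ bounded_linear_fst V(3)]
          Ck_on_linear[OF _ bounded_linear_snd]) auto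
    with o show "Ck_on k (V \<times> UNIV) \<Theta>"
      unfolding \<Theta>_def by (intro Ck_on_linear_comp[OF _ \<Phi>(1)])
  qed (use V in \<open>auto intro: open_Times\<close>)
  have rank: "dim (frechet_derivative \<Theta> (at (y, \<rho>)) ` (UNIV \<times> euc s)) + \<nu> = CARD('n) + s"
    if "y \<in> Y" for y \<rho>
  proof -
    let ?D = "frechet_derivative \<beta> (at y)"
    have "(\<beta> has_derivative ?D) (at (fst (y, \<rho>)))"
      using V(2,3) that by (auto intro!: Ck_on_SucD[where k = 0] simp del: Ck_on.simps)
    then have "((\<lambda>p. \<beta> (fst p)) has_derivative (\<lambda>p. ?D (fst p))) (at (y, \<rho>))"
      by (rule has_derivative_compose[OF has_derivative_fst[OF has_derivative_ident]])
    then have "(\<Theta> has_derivative (\<lambda>p. \<Phi> (?D (fst p), snd p))) (at (y, \<rho>))"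
      unfolding \<Theta>_def
      by (intro bounded_linear.has_derivative[OF \<Phi>(1)] has_derivative_Pair
          has_derivative_snd has_derivative_ident)
    then have eq: "frechet_derivative \<Theta> (at (y, \<rho>)) = (\<lambda>p. \<Phi> (?D (fst p), snd p))"
      by (rule frechet_derivative_at[symmetric])
    \<comment> \<open>Surjectivity of the derivative of \<open>\<beta>\<close> gives the derivative
      of \<open>\<Theta>\<close> the same image as \<open>\<Phi>\<close>, whatever the
      point.\<close>
    have "(\<lambda>p. (?D (fst p), snd p)) ` (UNIV \<times> euc s) = UNIV \<times> euc s"
      using \<beta>(2)[OF that] by (force simp: image_iff surj_def)
    then have "frechet_derivative \<Theta> (at (y, \<rho>)) ` (UNIV \<times> euc s) = \<Phi> ` (UNIV \<times> euc s)"
      unfolding eq by (metis (no_types, lifting) image_cong image_image)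
    then show ?thesis using dim by simp
  qed
  have mem: "(a (y, w, \<rho>) + t *\<^sub>R \<Theta> (y, \<rho>)) \<in> ?E" for y w \<rho> t
  proof -
    have "a (y, w, \<rho>) \<in> ?E" "\<Theta> (y, \<rho>) \<in> ?E" using a(2) \<Phi>(2) by (auto simp: \<Theta>_def)
    then show ?thesis by (simp add: euc_iff lookup_add)
  qed
  show ?thesis
    unfolding has_lift_def
  proof (intro exI conjI)
    show "openin (top_of_set (?E \<times> UNIV)) ((?E \<times> UNIV) \<inter> U)"
      using U(1) by (simp add: openin_open_Int)
    show "smooth_near ((?E \<times> UNIV) \<inter> U) \<pi>"
      using U(1) \<pi>_smooth by (intro smooth_nearI[where U = U]) auto
    show "\<forall>y\<in>Y. \<forall>w\<in>W. \<forall>\<rho>\<in>cball c r \<inter> euc s. \<forall>t\<in>I.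
        (a (y, w, \<rho>) + t *\<^sub>R \<Theta> (y, \<rho>), t) \<in> (?E \<times> UNIV) \<inter> U \<and>
        \<pi> (a (y, w, \<rho>) + t *\<^sub>R \<Theta> (y, \<rho>), t) = (X w t y, t)"
      using line mem by (auto simp: \<pi>_def \<Theta>_def)
  qed (use c a \<Theta>_smooth rank submersion \<Phi>(2) in \<open>auto simp: \<pi>_def \<Theta>_def\<close>)
qed

text \<open>Position \<open>k * CARD('n) + ix i\<close> holds coordinate \<open>i\<close> of block
  \<open>k\<close>; division with remainder recovers the block and the position within it.\<close>

lemma ix_add_div_mod [simp]:
  "(k * CARD('n) + ix (i :: 'n::finite)) div CARD('n) = k"
  "(k * CARD('n) + ix (i :: 'n::finite)) mod CARD('n) = ix i"
  using ix_less[of i] by (auto)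

lemma ix_add_less_iff [simp]:
  "k * CARD('n) + ix (i :: 'n::finite) < m * CARD('n) \<longleftrightarrow> k < m"
  by (metis div_less_iff_less_mult ix_add_div_mod(1) zero_less_card_finite)

section \<open>The quadratic family\<close>

text \<open>Once the first slope block is fixed, the parameter moves the slope only by its image
  under \<open>B\<close>, which fills the range of \<open>B ** B\<close>; this is the source of the
  rank defect.\<close>

lemma has_lift_X_quad:
  fixes B :: "real ^ 'n ^ 'n"
  shows "has_lift W I Y (X_quad B) (rank B) (rank B - rank (B ** B))"
proof -
  define d where "d = CARD('n)"
  define s where "s = rank B"
  have sub: "subspace (range ((*v) B))" "subspace (range ((*v) (B ** B)))"
    by (simp_all add: linear_subspace_image)
  \<comment> \<open>In an orthonormal basis the coordinates of a vector in the range of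
    \<open>B\<close> are inner products, which are linear on the whole space.\<close>
  obtain C where C: "C \<subseteq> range ((*v) B)" "pairwise orthogonal C" "\<And>x. x \<in> C \<Longrightarrow> norm x = 1"
    "independent C" "card C = dim (range ((*v) B))" "span C = range ((*v) B)"
    using orthonormal_basis_subspace[OF sub(1)] by metis
  have finC: "finite C" using C(4) by (rule independent_imp_finite)
  obtain b where b: "bij_betw b {..<s} C"
    using ex_bij_betw_nat_finite[OF finC] C(5) by (auto simp: s_def rank_dim_range atLeast0LessThan)
  have expand: "(\<Sum>j<s. (z \<bullet> b j) *\<^sub>R b j) = z" if "z \<in> range ((*v) B)" for z
    using orthonormal_basis_expand[OF C(2,3) _ finC, of z] that C(6)
      sum.reindex_bij_betw[OF b, of "\<lambda>i. (z \<bullet> i) *\<^sub>R i"] by simp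
  define J where "J = (\<lambda>f :: nat \<Rightarrow> real. \<Sum>j<s. f j *\<^sub>R b j)"
  have J: "J f \<in> range ((*v) B)" for f
    unfolding J_def using b C(1)
    by (intro subspace_sum[OF sub(1)] subspace_scale[OF sub(1)]) (auto simp: bij_betw_def)
  define F where "F = (\<lambda>p :: (nat \<Rightarrow>\<^sub>0 real) \<times> real. (\<chi> i :: 'n. Poly_Mapping.lookup (fst p) (ix i))
      + snd p *\<^sub>R J (\<lambda>j. Poly_Mapping.lookup (fst p) (d + j)))"
  define \<Phi> where "\<Phi> = (\<lambda>p :: (real ^ 'n) \<times> (nat \<Rightarrow>\<^sub>0 real). vec_euc (d + s) (\<lambda>k. if k < d
      then (fst p - J (Poly_Mapping.lookup (snd p))) $ inv ix k else (B *v fst p) \<bullet> b (k - d)))"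
  define a where "a = (\<lambda>p :: (real ^ 'n) \<times> (real ^ 'n) \<times> (nat \<Rightarrow>\<^sub>0 real). vec_euc (d + s)
      (\<lambda>k. if k < d then fst (snd p) $ inv ix k else Poly_Mapping.lookup (snd (snd p)) (k - d)))"
  have "bounded_linear (\<lambda>p :: (real ^ 'n) \<times> (nat \<Rightarrow>\<^sub>0 real). J (Poly_Mapping.lookup (snd p)))"
    unfolding J_def
    by (intro bounded_linear_sum bounded_linear_compose[OF bounded_linear_scaleR_left]
        bounded_linear_compose[OF bounded_linear_lookup] bounded_linear_snd)
  then have \<Phi>: "bounded_linear \<Phi>"
    unfolding \<Phi>_def
    by (intro bounded_linear_vec_euc)
      (auto intro!: bounded_linear_if bounded_linear_sub bounded_linear_fst bounded_linear_compose[OF bounded_linear_vec_nth]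
        bounded_linear_compose[OF bounded_linear_inner_left]
        bounded_linear_compose[OF matrix_vector_mul_bounded_linear])
  \<comment> \<open>Parametrises the image of \<open>\<Phi>\<close>: with
    \<open>x = y - J \<rho>\<close> and \<open>z = B (J \<rho>)\<close> in the range of
    \<open>B ** B\<close>, the second slope \<open>B y\<close> is \<open>B x + z\<close>.\<close>
  define P where "P = (\<lambda>p :: (real ^ 'n) \<times> (real ^ 'n). vec_euc (d + s)
      (\<lambda>k. if k < d then fst p $ inv ix k else (B *v fst p + snd p) \<bullet> b (k - d)))"
  let ?S = "UNIV \<times> range ((*v) (B ** B)) :: ((real ^ 'n) \<times> (real ^ 'n)) set"
  have image: "\<Phi> ` (UNIV \<times> euc s) = P ` ?S"
  proof (intro subset_antisym image_subsetI; clarify)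
    fix y :: "real ^ 'n" and \<rho> assume "\<rho> \<in> euc s"
    let ?x = "J (Poly_Mapping.lookup \<rho>)"
    obtain v where "?x = B *v v" using J by blast
    then have "(y - ?x, B *v ?x) \<in> ?S" by (simp add: matrix_vector_mul_assoc)
    moreover have "\<Phi> (y, \<rho>) = P (y - ?x, B *v ?x)"
      by (simp add: \<Phi>_def P_def matrix_vector_mult_diff_distrib cong: if_cong)
    ultimately show "\<Phi> (y, \<rho>) \<in> P ` ?S" by (metis imageI)
  next
    fix x v :: "real ^ 'n"
    \<comment> \<open>The parameter with \<open>J \<rho> = B v\<close>; then
      \<open>y = x + B v\<close> has first slope block \<open>x\<close>.\<close>
    let ?\<rho> = "vec_euc s (\<lambda>j. (B *v v) \<bullet> b j)"
    have J\<rho>: "J (Poly_Mapping.lookup ?\<rho>) = B *v v"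
      using expand[of "B *v v"] by (simp add: J_def lookup_vec_euc)
    then have "P (x, (B ** B) *v v) = \<Phi> (x + B *v v, ?\<rho>)"
      by (simp add: \<Phi>_def P_def matrix_vector_mul_assoc[symmetric] matrix_vector_right_distrib cong: if_cong)
    then show "P (x, (B ** B) *v v) \<in> \<Phi> ` (UNIV \<times> euc s)"
      by (rule image_eqI) simp
  qed
  have "dim (P ` ?S) = dim ?S"
  proof (rule dim_injective_image)
    show lin: "linear P"
      unfolding P_def
      by (rule bounded_linear.linear, rule bounded_linear_vec_euc)
        (auto intro!: bounded_linear_if bounded_linear_add bounded_linear_fst bounded_linear_snd
          bounded_linear_compose[OF bounded_linear_vec_nth]
          bounded_linear_compose[OF bounded_linear_inner_left]
          bounded_linear_compose[OF matrix_vector_mul_bounded_linear])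
    show subS: "subspace ?S" by (intro subspace_Times subspace_UNIV sub)
    show "inj_on P ?S"
      unfolding linear_injective_on_subspace_0[OF lin subS]
    proof (intro ballI impI)
      fix p assume p: "p \<in> ?S" and 0: "P p = 0"
      have x: "fst p $ i = 0" for i
        using arg_cong[OF 0, of "\<lambda>z. Poly_Mapping.lookup z (ix i)"]
        by (simp add: P_def lookup_vec_euc d_def trans_less_add1)
      then have x: "fst p = 0" by (simp add: vec_eq_iff)
      have "snd p \<bullet> b j = 0" if "j < s" for j
        using arg_cong[OF 0, of "\<lambda>z. Poly_Mapping.lookup z (d + j)"] that
        by (simp add: P_def lookup_vec_euc x)
      \<comment> \<open>The range of \<open>B ** B\<close> lies in that of \<open>B\<close>, where
        vanishing basis coordinates force a vector to vanish.\<close>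
      moreover have "snd p \<in> range ((*v) B)" using p by (auto simp: matrix_vector_mul_assoc[symmetric])
      ultimately have "snd p = 0" using expand[of "snd p"] by simp
      with x show "p = 0" by (simp add: prod_eq_iff)
    qed
  qed
  also have "\<dots> = d + rank (B ** B)"
    by (simp add: dim_Times sub rank_dim_range d_def)
  \<comment> \<open>The rank of \<open>B ** B\<close> is at most that of \<open>B\<close>, so the
    natural subtraction is exact.\<close>
  finally have dim: "dim (\<Phi> ` (UNIV \<times> euc s)) + (s - rank (B ** B)) = d + s"
    using rank_mul_le_left[of B B] unfolding image by (simp add: s_def)
  have "has_lift W I Y (X_quad B) s (s - rank (B ** B))"
  proof (rule has_liftI[where c = 0 and r = 1 and U = UNIV and F = F and \<Phi> = \<Phi> and \<beta> = "\<lambda>y. y"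
        and a = a])
    show "Ck_on k UNIV F" for k
      unfolding F_def J_def by (intro Ck_on_intros Ck_on_vec_lambda open_UNIV)
    show "F (z + emb x, t) = F (z, t) + x" for z x t
      by (simp add: F_def vec_eq_iff lookup_add lookup_emb d_def)
    show "smooth_near (Y \<times> W \<times> (cball 0 1 \<inter> euc s)) a"
    proof (rule smooth_nearI[where U = UNIV])
      show "Ck_on k UNIV a" for k
        unfolding a_def
        by (intro Ck_on_vec_euc open_UNIV) (auto intro!: Ck_on_intros)
    qed auto
    show "smooth_near Y (\<lambda>y. y)"
      by (rule smooth_nearI[where U = UNIV]) (auto intro: Ck_on_id)
    show "surj (frechet_derivative (\<lambda>y :: real ^ 'n. y) (at y))" for y
      by (simp add: frechet_derivative_at[OF has_derivative_ident, symmetric] surj_id)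
    show "range a \<subseteq> euc (CARD('n) + s)" "range \<Phi> \<subseteq> euc (CARD('n) + s)"
      by (auto simp: a_def \<Phi>_def simp flip: d_def)
    fix y w \<rho> t
    \<comment> \<open>The shifts by \<open>t *\<^sub>R J \<rho>\<close> cancel between the two
      blocks, and the last sum is \<open>B y\<close>.\<close>
    have "F (a (y, w, \<rho>) + t *\<^sub>R \<Phi> (y, \<rho>), t)
        = w + t *\<^sub>R (y - J (Poly_Mapping.lookup \<rho>))
          + t *\<^sub>R (J (Poly_Mapping.lookup \<rho>) + t *\<^sub>R (\<Sum>j<s. ((B *v y) \<bullet> b j) *\<^sub>R b j))"
      by (simp add: F_def a_def \<Phi>_def J_def vec_eq_iff lookup_add lookup_vec_euc d_def
          trans_less_add1 trans_less_add2 algebra_simps sum.distrib scaleR_sum_right sum_distrib_left)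
    also have "\<dots> = X_quad B w t y"
      by (simp add: expand X_quad_def matrix_vector_mult_add_rdistrib scaleR_matrix_vector_assoc[symmetric]
          algebra_simps power2_eq_square)
    finally show "(a (y, w, \<rho>) + t *\<^sub>R \<Phi> (y, \<rho>), t) \<in> UNIV \<and>
        F (a (y, w, \<rho>) + t *\<^sub>R \<Phi> (y, \<rho>), t) = X_quad B w t y" by simp
  qed (use \<Phi> dim in \<open>auto simp: d_def euc_iff\<close>)
  then show ?thesis by (simp add: s_def)
qed

section \<open>The polynomial family\<close>

text \<open>An injective linear endomorphism of a finite-dimensional space is surjective; this turns
  the determinant condition into what \<open>has_liftI\<close> asks of
  \<open>\<beta>\<close>.\<close>

lemma surj_frechet_derivative:
  fixes f :: "real ^ 'n \<Rightarrow> real ^ 'n"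
  assumes "f differentiable at x" "det (jacobian f (at x)) \<noteq> 0"
  shows "surj (frechet_derivative f (at x))"
proof -
  have lin: "linear (frechet_derivative f (at x))"
    using assms(1) by (rule linear_frechet_derivative)
  then have "inj (frechet_derivative f (at x))"
    using assms(2) det_nz_iff_inj by (auto simp: jacobian_def)
  with lin show ?thesis by (rule linear_injective_imp_surjective) simp
qed

text \<open>Free slopes fill the first \<open>E\<close> blocks and \<open>B y\<close> fills the
  last, so the linear slope map is onto. Writing the degree as \<open>Suc E\<close> avoids truncated
  subtraction in counting blocks.\<close>

lemma has_lift_X_poly:
  fixes A :: "nat \<Rightarrow> real ^ 'n \<Rightarrow> real ^ 'n \<Rightarrow> real ^ 'n"
  assumes A: "\<And>i. i < Suc E \<Longrightarrow> smooth_near (W \<times> Y) (\<lambda>(w, y). A i w y)"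
    and B: "smooth_near Y B" "\<And>y. y \<in> Y \<Longrightarrow> det (jacobian B (at y)) \<noteq> 0"
  shows "has_lift W I Y (X_poly (Suc E) A B) (E * CARD('n)) 0"
proof -
  define d where "d = CARD('n)"
  have d: "d > 0" by (simp add: d_def)
  define s where "s = E * d"
  have ds: "d + s = Suc E * d" by (simp add: s_def)
  have coord_less: "k * d + ix (i :: 'n) < d + s \<longleftrightarrow> k < Suc E" for k i
    unfolding ds by (simp only: d_def ix_add_less_iff)
  have coord_less': "k * d + ix (i :: 'n) < s \<longleftrightarrow> k < E" for k i
    by (simp only: s_def d_def ix_add_less_iff)
  have coord_less_d: "k * d + ix (i :: 'n) < d \<longleftrightarrow> k = 0" for k i
    using ix_add_less_iff[of k i 1] by (simp add: d_def)
  have coord: "(k * d + ix (i :: 'n)) div d = k" "inv ix ((k * d + ix i) mod d) = i" for k i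
    by (simp_all add: d_def)
  define F where "F = (\<lambda>p :: (nat \<Rightarrow>\<^sub>0 real) \<times> real.
      \<Sum>k<Suc E. snd p ^ k *\<^sub>R (\<chi> i :: 'n. Poly_Mapping.lookup (fst p) (k * d + ix i)))"
  \<comment> \<open>Since \<open>s = E * d\<close>, the positions from \<open>s\<close> on form the
    last block, and \<open>k mod d\<close> is the position within a block.\<close>
  define \<Phi> where "\<Phi> = (\<lambda>p :: (real ^ 'n) \<times> (nat \<Rightarrow>\<^sub>0 real). vec_euc (d + s) (\<lambda>k.
      if k < s then Poly_Mapping.lookup (snd p) k else fst p $ inv ix (k mod d)))"
  \<comment> \<open>Block \<open>k\<close> starts at \<open>A k\<close> minus block
    \<open>k - 1\<close> of \<open>\<rho>\<close>; the positions below \<open>d\<close> form block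
    0, which has no predecessor.\<close>
  define a where "a = (\<lambda>p :: (real ^ 'n) \<times> (real ^ 'n) \<times> (nat \<Rightarrow>\<^sub>0 real). vec_euc (d + s) (\<lambda>k.
      A (k div d) (fst (snd p)) (fst p) $ inv ix (k mod d)
      - (if k < d then 0 else Poly_Mapping.lookup (snd (snd p)) (k - d))))"
  have "\<exists>U. \<forall>i<Suc E. open (U i) \<and> W \<times> Y \<subseteq> U i \<and> (\<forall>k. Ck_on k (U i) (\<lambda>(w, y). A i w y))"
    using A unfolding smooth_near_def by metis
  then obtain U where U: "\<And>i. i < Suc E \<Longrightarrow> open (U i)" "\<And>i. i < Suc E \<Longrightarrow> W \<times> Y \<subseteq> U i"
    "\<And>i k. i < Suc E \<Longrightarrow> Ck_on k (U i) (\<lambda>(w, y). A i w y)"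
    by blast
  obtain U' where U': "open U'" "Y \<subseteq> U'" "\<And>k. Ck_on k U' B"
    using B(1) by (auto simp: smooth_near_def)
  \<comment> \<open>Swaps \<open>y\<close> and \<open>w\<close> to match the argument order of
    \<open>A\<close>; the common neighbourhood \<open>V\<close> is then the preimage of a finite
    intersection.\<close>
  define L where "L = (\<lambda>p :: (real ^ 'n) \<times> (real ^ 'n) \<times> (nat \<Rightarrow>\<^sub>0 real). (fst (snd p), fst p))"
  have L: "bounded_linear L"
    unfolding L_def
    by (intro bounded_linear_Pair bounded_linear_fst bounded_linear_compose[OF bounded_linear_fst]
        bounded_linear_snd)
  define V where "V = L -` (\<Inter>i<Suc E. U i)"
  have V: "open V"
    unfolding V_def using U(1) L
    by (intro open_vimage open_INT) (auto intro: linear_continuous_on)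
  have image: "\<Phi> ` (UNIV \<times> euc s) = euc (d + s)"
  proof
    show "\<Phi> ` (UNIV \<times> euc s) \<subseteq> euc (d + s)" by (auto simp: \<Phi>_def)
    show "euc (d + s) \<subseteq> \<Phi> ` (UNIV \<times> euc s)"
    proof
      fix z assume z: "z \<in> euc (d + s)"
      \<comment> \<open>The last block of \<open>z\<close> becomes the vector argument and its first
        \<open>s\<close> coordinates become the parameter.\<close>
      let ?p = "((\<chi> i. Poly_Mapping.lookup z (s + ix i)) :: real ^ 'n,
          vec_euc s (Poly_Mapping.lookup z))"
      have "\<Phi> ?p = vec_euc (d + s) (Poly_Mapping.lookup z)"
      proof (rule poly_mapping_eqI)
        fix k
        have "s + k mod d = k" if "\<not> k < s" "k < d + s"
        proof -
          have "k mod d = (k - s) mod d"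
            using that(1) mod_mult_self3[of E d "k - s"] by (simp add: s_def)
          with that show ?thesis by simp
        qed
        then show "Poly_Mapping.lookup (\<Phi> ?p) k
            = Poly_Mapping.lookup (vec_euc (d + s) (Poly_Mapping.lookup z)) k"
          using d by (simp add: \<Phi>_def lookup_vec_euc d_def)
      qed
      then have "z = \<Phi> ?p" using vec_euc_lookup[OF z] by simp
      then show "z \<in> \<Phi> ` (UNIV \<times> euc s)" by (rule image_eqI) simp
    qed
  qed
  have "has_lift W I Y (X_poly (Suc E) A B) s 0"
  proof (rule has_liftI[where c = 0 and r = 1 and U = UNIV and F = F and \<Phi> = \<Phi> and \<beta> = B
        and a = a])
    show "Ck_on k UNIV F" for k
      unfolding F_def by (intro Ck_on_intros Ck_on_vec_lambda open_UNIV)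
    show "F (z + emb x, t) = F (z, t) + x" for z x t
    proof -
      have emb: "Poly_Mapping.lookup (emb x) (k * d + ix i) = (if k = 0 then x $ i else 0)" for k i
        by (simp add: lookup_emb coord_less_d[unfolded d_def] d_def)
      show ?thesis
        by (simp add: F_def vec_eq_iff lookup_add emb emb[of 0, simplified] sum.lessThan_Suc_shift
            del: sum.lessThan_Suc mult_Suc)
    qed
    show "bounded_linear \<Phi>"
      unfolding \<Phi>_def
      by (intro bounded_linear_vec_euc bounded_linear_if bounded_linear_fst bounded_linear_snd
          bounded_linear_compose[OF bounded_linear_lookup]
          bounded_linear_compose[OF bounded_linear_vec_nth])
    show "smooth_near (Y \<times> W \<times> (cball 0 1 \<inter> euc s)) a"
    proof (rule smooth_nearI[OF V])
      show "Y \<times> W \<times> (cball 0 1 \<inter> euc s) \<subseteq> V"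
        using U(2) by (fastforce simp: V_def L_def)
      show "Ck_on k V a" for k
      proof -
        have "Ck_on k V (\<lambda>p. A j (fst (snd p)) (fst p))" if "j < Suc E" for j
          using Ck_on_comp_linear[OF V L U(3)[OF that], of k] that by (auto simp: L_def V_def)
        then have "Ck_on k V (\<lambda>p. A (j div d) (fst (snd p)) (fst p))" if "j < d + s" for j
          using that d unfolding ds by (simp add: less_mult_imp_div_less)
        then show ?thesis
          unfolding a_def using V by (intro Ck_on_vec_euc Ck_on_intros) auto
      qed
    qed
    show "surj (frechet_derivative B (at y))" if "y \<in> Y" for y
      using that U'(2) U'(3)[of "Suc 0"] B(2) by (intro surj_frechet_derivative) auto
    show "dim (\<Phi> ` (UNIV \<times> euc s)) + 0 = CARD('n) + s"
      by (simp add: image dim_euc d_def)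
    show "range a \<subseteq> euc (CARD('n) + s)" "range \<Phi> \<subseteq> euc (CARD('n) + s)"
      by (auto simp: a_def \<Phi>_def simp flip: d_def)
    fix y w \<rho> t
    define p where "p = a (y, w, \<rho>) + t *\<^sub>R \<Phi> (B y, \<rho>)"
    have "F (p, t) $ i = X_poly (Suc E) A B w t y $ i" for i
    proof -
      \<comment> \<open>\<open>g k\<close> is the contribution of block \<open>k - 1\<close> of
        \<open>\<rho>\<close> at order t^k: the offset of block \<open>k\<close> subtracts it and
        the slope of block \<open>k - 1\<close> adds it. The value \<open>g 0 = 0\<close> stands for
        the missing predecessor of block 0.\<close>
      define g where "g k = (if k = 0 then 0
          else t ^ k * Poly_Mapping.lookup \<rho> ((k - 1) * d + ix i))" for k
      have sub: "k * d + ix i - d = (k - 1) * d + ix i" if "k \<noteq> 0" for k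
        using that by (cases k) auto
      have lookup_p: "Poly_Mapping.lookup p (k * d + ix i) = A k w y $ i
          - (if k = 0 then 0 else Poly_Mapping.lookup \<rho> ((k - 1) * d + ix i))
          + t * (if k < E then Poly_Mapping.lookup \<rho> (k * d + ix i) else B y $ i)"
        if "k < Suc E" for k
        using that by (simp add: p_def a_def \<Phi>_def lookup_add lookup_vec_euc coord_less coord_less'
            coord_less_d coord coord(2)[of 0, simplified] sub cong: if_cong del: mult_Suc)
      have "F (p, t) $ i = (\<Sum>k<Suc E. t ^ k * Poly_Mapping.lookup p (k * d + ix i))"
        by (simp add: F_def)
      also have "\<dots> = (\<Sum>k<Suc E. t ^ k * A k w y $ i
          + ((if k < E then g (Suc k) else t ^ Suc k * B y $ i) - g k))"
        by (intro sum.cong refl) (simp add: lookup_p g_def right_diff_distrib distrib_left)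
      also have "\<dots> = (\<Sum>k<Suc E. t ^ k * A k w y $ i)
          + ((\<Sum>k<E. g (Suc k) - g k) + (t ^ Suc E * B y $ i - g E))"
        by (simp add: sum.distrib)
      \<comment> \<open>The boundary value \<open>g E\<close> cancels against the offset of the last
        block.\<close>
      also have "(\<Sum>k<E. g (Suc k) - g k) = g E"
        by (subst sum_lessThan_telescope) (simp add: g_def)
      finally show ?thesis
        by (simp add: X_poly_def)
    qed
    then show "(a (y, w, \<rho>) + t *\<^sub>R \<Phi> (B y, \<rho>), t) \<in> UNIV \<and>
        F (a (y, w, \<rho>) + t *\<^sub>R \<Phi> (B y, \<rho>), t) = X_poly (Suc E) A B w t y"
      by (simp add: p_def vec_eq_iff)
  qed (use B(1) in \<open>auto simp: euc_iff\<close>)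
  then show ?thesis by (simp add: s_def d_def)
qed

section \<open>The tangent example\<close>

text \<open>Up to signs and a permutation, the slope coordinates are exactly the n - 1 coordinates
  of \<open>y\<close> and the n coordinates of \<open>\<rho>\<close>, so the rank is full.\<close>

lemma has_lift_X_tan:
  fixes l :: "'n::finite"
  shows "has_lift (cube (1/10)) {9/10..11/10} (cube (1/10)) (X_tan l) (CARD('n) + 1) 0"
proof -
  define d where "d = CARD('n)"
  have ix_d [simp]: "ix (i :: 'n) < d" for i by (simp add: d_def)
  have ix_simps [simp]: "ix (i :: 'n) < Suc (d + d)" "ix (i :: 'n) < Suc d" "ix (i :: 'n) \<noteq> d" "d \<noteq> ix (i :: 'n)" for i
    using ix_d[of i] by linarith+
  txt \<open>In \<open>F\<close>, the slots \<open>2 * d\<close> and \<open>d + ix l\<close> hold \<open>p\<close> and \<open>q\<close>; in \<open>\<rho>\<close>, the slots \<open>d\<close> and \<open>ix l\<close> hold \<open>u\<close> and \<open>v\<close>.\<close>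
  define F where "F = (\<lambda>p :: (nat \<Rightarrow>\<^sub>0 real) \<times> real. \<chi> i :: 'n.
      Poly_Mapping.lookup (fst p) (ix i) +
      (if i = l
       then arctan (Poly_Mapping.lookup (fst p) (d + ix l) * inverse (Poly_Mapping.lookup (fst p) (2 * d)))
       else snd p * Poly_Mapping.lookup (fst p) (d + ix i)))"
  define \<Phi> where "\<Phi> = (\<lambda>p :: (real ^ 'n) \<times> (nat \<Rightarrow>\<^sub>0 real). vec_euc (d + d + 1) (\<lambda>k.
      if k < d then (if k = ix l then - fst p $ l else Poly_Mapping.lookup (snd p) k)
      else if k = 2 * d then Poly_Mapping.lookup (snd p) d
      else if k = d + ix l then Poly_Mapping.lookup (snd p) (ix l)
      else - fst p $ inv ix (k - d)))"
  \<comment> \<open>For the last coordinate, \<open>- v w\<close> and \<open>u w\<close> are the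
    terms free of \<open>t\<close> in the real and imaginary parts of (u + i v)(t + i w). For the
    others, the offset \<open>- \<rho>\<close> cancels the slope \<open>\<rho>\<close> of the first
    block.\<close>
  define a where "a = (\<lambda>p :: (real ^ 'n) \<times> (real ^ 'n) \<times> (nat \<Rightarrow>\<^sub>0 real).
      case p of (y, w, \<rho>) \<Rightarrow> vec_euc (d + d + 1) (\<lambda>k.
      if k < d then
        (if k = ix l
         then - arctan (Poly_Mapping.lookup \<rho> (ix l) * inverse (Poly_Mapping.lookup \<rho> d))
         else w $ inv ix k)
      else if k = 2 * d then - Poly_Mapping.lookup \<rho> (ix l) * w $ l
      else if k = d + ix l then Poly_Mapping.lookup \<rho> d * w $ l
      else - Poly_Mapping.lookup \<rho> (k - d)))"
  \<comment> \<open>The centre has \<open>u = 1\<close> and \<open>v = 0\<close>; radius 1/10 keeps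
    \<open>u\<close> at least 9/10 and \<open>v\<close> within 1/10 of zero.\<close>
  define c where "c = Poly_Mapping.single d (1 :: real)"
  let ?R = "cball c (1/10) \<inter> euc (d + 1)"
  \<comment> \<open>Positivity of the denominators, \<open>p\<close> here and \<open>u\<close> in
    \<open>V\<close>, keeps the arctangent terms smooth.\<close>
  define U where "U = {p :: (nat \<Rightarrow>\<^sub>0 real) \<times> real. 0 < Poly_Mapping.lookup (fst p) (2 * d)}"
  define V where "V = {p :: (real ^ 'n) \<times> (real ^ 'n) \<times> (nat \<Rightarrow>\<^sub>0 real).
      0 < Poly_Mapping.lookup (snd (snd p)) d}"
  have R: "9/10 \<le> Poly_Mapping.lookup \<rho> d" "\<bar>Poly_Mapping.lookup \<rho> (ix l)\<bar> \<le> 1/10" if "\<rho> \<in> ?R" for \<rho>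
  proof -
    have "\<bar>Poly_Mapping.lookup (c - \<rho>) k\<bar> \<le> 1/10" for k
      using that abs_lookup_le_norm[of "c - \<rho>" k] by (simp add: dist_norm)
    moreover have "Poly_Mapping.lookup (c - \<rho>) d = 1 - Poly_Mapping.lookup \<rho> d"
      "Poly_Mapping.lookup (c - \<rho>) (ix l) = - Poly_Mapping.lookup \<rho> (ix l)"
      by (simp_all add: c_def lookup_minus lookup_single)
    ultimately have "\<bar>1 - Poly_Mapping.lookup \<rho> d\<bar> \<le> 1/10" "\<bar>- Poly_Mapping.lookup \<rho> (ix l)\<bar> \<le> 1/10"
      by metis+
    then show "9/10 \<le> Poly_Mapping.lookup \<rho> d" "\<bar>Poly_Mapping.lookup \<rho> (ix l)\<bar> \<le> 1/10"
      by linarith+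
  qed
  have open_pos: "open {x. 0 < f x}" if "Ck_on 0 UNIV f" for f :: "'b::real_normed_vector \<Rightarrow> real"
    using that by (intro open_Collect_less) auto
  have U: "open U"
    unfolding U_def by (intro open_pos Ck_on_intros open_UNIV)
  have V: "open V"
    unfolding V_def by (intro open_pos Ck_on_intros open_UNIV)
  have image: "\<Phi> ` (UNIV \<times> euc (d + 1)) = euc (d + d + 1)"
  proof
    show "\<Phi> ` (UNIV \<times> euc (d + 1)) \<subseteq> euc (d + d + 1)" by (auto simp: \<Phi>_def)
    show "euc (d + d + 1) \<subseteq> \<Phi> ` (UNIV \<times> euc (d + 1))"
    proof
      fix z assume z: "z \<in> euc (d + d + 1)"
      let ?z = "Poly_Mapping.lookup z"
      \<comment> \<open>Undoes the signed permutation of coordinates performed by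
        \<open>\<Phi>\<close>.\<close>
      let ?p = "((\<chi> i :: 'n. - ?z (if i = l then ix l else d + ix i)),
          vec_euc (d + 1) (\<lambda>k. ?z (if k = ix l then d + ix l else if k = d then 2 * d else k)))"
      have "\<Phi> ?p = vec_euc (d + d + 1) ?z"
      proof (rule poly_mapping_eqI)
        fix k
        consider "k < d" | "k = 2 * d" | "d \<le> k" "k < 2 * d" | "2 * d < k" by linarith
        then show "Poly_Mapping.lookup (\<Phi> ?p) k = Poly_Mapping.lookup (vec_euc (d + d + 1) ?z) k"
        proof cases
          case 3
          define i where "i = (inv ix (k - d) :: 'n)"
          have "k = d + ix i" using 3 by (simp add: i_def d_def)
          then show ?thesis by (simp add: \<Phi>_def lookup_vec_euc)
        qed (auto simp: \<Phi>_def lookup_vec_euc)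
      qed
      then have "z = \<Phi> ?p" using vec_euc_lookup[OF z] by simp
      then show "z \<in> \<Phi> ` (UNIV \<times> euc (d + 1))" by (rule image_eqI) simp
    qed
  qed
  have "has_lift (cube (1/10)) {9/10..11/10} (cube (1/10)) (X_tan l) (d + 1) 0"
  proof (rule has_liftI[where c = c and r = "1/10" and U = U and F = F and \<Phi> = \<Phi>
        and \<beta> = "\<lambda>y. y" and a = a])
    show "c \<in> euc (d + 1)" by (auto simp: c_def euc_iff lookup_single when_def)
    show "Ck_on k U F" for k
      unfolding F_def using U
      by (intro Ck_on_vec_lambda Ck_on_intros Ck_on_arctan Ck_on_inverse) (auto simp: U_def)
    show "F (z + emb x, t) = F (z, t) + x" for z x t
      by (simp add: F_def vec_eq_iff lookup_add lookup_emb flip: d_def)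
    show "bounded_linear \<Phi>"
      unfolding \<Phi>_def
      by (intro bounded_linear_vec_euc bounded_linear_if bounded_linear_minus
          bounded_linear_fst bounded_linear_snd bounded_linear_compose[OF bounded_linear_lookup]
          bounded_linear_compose[OF bounded_linear_vec_nth])
    show "smooth_near (cube (1/10) \<times> cube (1/10) \<times> ?R) a"
    proof (rule smooth_nearI[OF V])
      show "cube (1/10) \<times> cube (1/10) \<times> ?R \<subseteq> V"
        using R(1) by (fastforce simp: V_def)
      show "Ck_on k V a" for k
        unfolding a_def case_prod_unfold using V
        by (intro Ck_on_vec_euc Ck_on_intros Ck_on_arctan Ck_on_inverse) (auto simp: V_def)
    qed
    show "smooth_near (cube (1/10)) (\<lambda>y :: real ^ 'n. y)"
      by (rule smooth_nearI[where U = UNIV]) (auto intro: Ck_on_id)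
    show "surj (frechet_derivative (\<lambda>y :: real ^ 'n. y) (at y))" for y
      by (simp add: frechet_derivative_at[OF has_derivative_ident, symmetric] surj_id)
    show "dim (\<Phi> ` (UNIV \<times> euc (d + 1))) + 0 = CARD('n) + (d + 1)"
      unfolding image by (simp add: dim_euc d_def)
    show "range a \<subseteq> euc (CARD('n) + (d + 1))" "range \<Phi> \<subseteq> euc (CARD('n) + (d + 1))"
      by (auto simp: a_def \<Phi>_def d_def add.assoc[symmetric] simp del: add_Suc_right)
    fix y w :: "real ^ 'n" and \<rho> t
    assume "w \<in> cube (1/10)" and \<rho>: "\<rho> \<in> ?R" and t: "t \<in> {9/10..11/10 :: real}"
    then have "- (1/10) \<le> w $ l \<and> w $ l \<le> 1/10" by (simp add: cube_def mem_box_cart)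
    then have w: "\<bar>w $ l\<bar> \<le> 1/10" by linarith
    define u where "u = Poly_Mapping.lookup \<rho> d"
    define v where "v = Poly_Mapping.lookup \<rho> (ix l)"
    have u: "9/10 \<le> u" and v: "\<bar>v\<bar> \<le> 1/10" using R[OF \<rho>] by (auto simp: u_def v_def)
    define p where "p = a (y, w, \<rho>) + t *\<^sub>R \<Phi> (y, \<rho>)"
    have p: "Poly_Mapping.lookup p (2 * d) = t * u - v * w $ l"
      "Poly_Mapping.lookup p (d + ix l) = u * w $ l + t * v"
      "Poly_Mapping.lookup p (ix l) = - arctan (v * inverse u) - t * y $ l"
      by (simp_all add: p_def a_def \<Phi>_def lookup_add lookup_vec_euc u_def v_def)
    have p': "Poly_Mapping.lookup p (ix i) = w $ i + t * Poly_Mapping.lookup \<rho> (ix i)"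
      "Poly_Mapping.lookup p (d + ix i) = - Poly_Mapping.lookup \<rho> (ix i) - t * y $ i"
      if "i \<noteq> l" for i
      using that by (simp_all add: p_def a_def \<Phi>_def lookup_add lookup_vec_euc)
    \<comment> \<open>The product \<open>v * w $ l\<close> is at most 1/100 in absolute value while
      \<open>t * u\<close> is at least 81/100, so the line stays in \<open>U\<close>.\<close>
    have "\<bar>v * w $ l\<bar> \<le> 1/10 * (1/10)"
      using v w unfolding abs_mult by (intro mult_mono) auto
    moreover have "9/10 * (9/10) \<le> t * u" using t u by (intro mult_mono) auto
    ultimately have pos: "0 < t * u - v * w $ l" by linarith
    \<comment> \<open>Both quotients are at most 1/9 in absolute value, so the addition formula
      holds without a shift by pi.\<close>
    have "arctan (w $ l / t) + arctan (v / u)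
        = arctan ((w $ l / t + v / u) / (1 - (w $ l / t) * (v / u)))"
      using t u v w by (intro arctan_add) (auto simp: divide_simps)
    also have "(w $ l / t + v / u) / (1 - (w $ l / t) * (v / u))
        = (u * w $ l + t * v) / (t * u - v * w $ l)"
      using t u pos by (simp add: field_simps)
    finally have eq: "arctan (w $ l / t)
        = arctan ((u * w $ l + t * v) * inverse (t * u - v * w $ l)) - arctan (v * inverse u)"
      by (simp add: divide_inverse)
    have "F (p, t) $ i = X_tan l w t y $ i" for i
      by (simp add: F_def p p' X_tan_def eq right_diff_distrib power2_eq_square)
    with pos show "(a (y, w, \<rho>) + t *\<^sub>R \<Phi> (y, \<rho>), t) \<in> U \<and>
        F (a (y, w, \<rho>) + t *\<^sub>R \<Phi> (y, \<rho>), t) = X_tan l w t y"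
      using p(1) by (simp add: U_def vec_eq_iff flip: p_def)
  qed (simp_all add: U)
  then show ?thesis by (simp add: d_def)
qed

section \<open>The quadratic, polynomial and tangent cases combined\<close>

theorem proposition2p5:
  fixes n :: nat
  assumes "n \<ge> 3" and "CARD('n::finite) = n - 1"
  shows
    "(\<forall>(B :: real ^ 'n ^ 'n) c r \<tau>.
        r > 0 \<and> \<tau> > 0 \<and>
        hormander_type (cball c r) {-\<tau>..\<tau>} (cube 1) (X_quad B) \<longrightarrow>
        has_lift (cball c r) {-\<tau>..\<tau>} (cube 1) (X_quad B) (rank B) (rank B - rank (B ** B)))
     \<and>
     (\<forall>D (A :: nat \<Rightarrow> real ^ 'n \<Rightarrow> real ^ 'n \<Rightarrow> real ^ 'n) (B :: real ^ 'n \<Rightarrow> real ^ 'n)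
         W Y cW rW cY rY \<alpha> \<beta>.
        D \<ge> 1 \<and> rW > 0 \<and> W = cball cW rW \<and> rY > 0 \<and> Y = cball cY rY \<and> \<alpha> \<le> \<beta> \<and>
        (\<forall>i<D. smooth_near (W \<times> Y) (\<lambda>(w, y). A i w y)) \<and>
        smooth_near Y B \<and>
        (\<forall>y\<in>Y. det (jacobian B (at y)) \<noteq> 0) \<and>
        hormander_type W {\<alpha>..\<beta>} Y (X_poly D A B) \<longrightarrow>
        has_lift W {\<alpha>..\<beta>} Y (X_poly D A B) ((D - 1) * (n - 1)) 0)
     \<and>
     (\<forall>l :: 'n. has_lift (cube 0.1) {0.9..1.1} (cube 0.1) (X_tan l) n 0)"
proof (intro conjI allI impI)
  fix B :: "real ^ 'n ^ 'n" and c :: "real ^ 'n" and r \<tau> :: real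
  show "has_lift (cball c r) {-\<tau>..\<tau>} (cube 1) (X_quad B) (rank B) (rank B - rank (B ** B))"
    by (rule has_lift_X_quad)
next
  fix D and A :: "nat \<Rightarrow> real ^ 'n \<Rightarrow> real ^ 'n \<Rightarrow> real ^ 'n" and B :: "real ^ 'n \<Rightarrow> real ^ 'n"
    and W Y :: "(real ^ 'n) set" and cW rW cY rY \<alpha> \<beta>
  assume *: "D \<ge> 1 \<and> rW > 0 \<and> W = cball cW rW \<and> rY > 0 \<and> Y = cball cY rY \<and> \<alpha> \<le> \<beta> \<and>
        (\<forall>i<D. smooth_near (W \<times> Y) (\<lambda>(w, y). A i w y)) \<and>
        smooth_near Y B \<and>
        (\<forall>y\<in>Y. det (jacobian B (at y)) \<noteq> 0) \<and>
        hormander_type W {\<alpha>..\<beta>} Y (X_poly D A B)"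
  then obtain E where D: "D = Suc E" by (cases D) auto
  have "has_lift W {\<alpha>..\<beta>} Y (X_poly (Suc E) A B) (E * CARD('n)) 0"
    using * unfolding D by (intro has_lift_X_poly) blast+
  then show "has_lift W {\<alpha>..\<beta>} Y (X_poly D A B) ((D - 1) * (n - 1)) 0"
    using assms(2) D by simp
next
  fix l :: 'n
  show "has_lift (cube 0.1) {0.9..1.1} (cube 0.1) (X_tan l) n 0"
    \<comment> \<open>Here \<open>n \<ge> 3\<close> ensures that \<open>n - 1 + 1 = n\<close>
      despite truncated subtraction.\<close>
    using has_lift_X_tan[of l] assms by simp
qed

end
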